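(* Suppose $A \in \mathcal{M}_n^{+}$ is an arrowhead matrix. Then $A$ has factor width at most $2$. Furthermore, $\mathrm{fran}_k(A) = \mathrm{rank}(A)$ for all integers $k \geq 2$.
   Context: Let $\mathbb{F} \in \{\mathbb{R},\mathbb{C}\}$ (the result holds for either field). $\mathcal{M}_n^{+}$ denotes the set of $n \times n$ positive semidefinite (real symmetric if $\mathbb{F}=\mathbb{R}$, Hermitian if $\mathbb{F}=\mathbb{C}$) matrices over $\mathbb{F}$. A matrix $A$ is an arrowhead matrix if $a_{i,j}=0$ whenever $i \neq 1$, $j \neq 1$ and $i \neq j$. The factor width of $A \in \mathcal{M}_n^{+}$ is the smallest positive integer $k$ such that $A = \sum_{j=1}^r \mathbf{v}_j\mathbf{v}_j^*$ for some $r$ and some $\mathbf{v}_1,\ldots,\mathbf{v}_r \in \mathbb{F}^n$, each with at most $k$ non-zero entries. If $A$ has factor width at most $k$, $\mathrm{fran}_k(A)$ (the factor-width-$k$ rank) is the least integer $r$ for which such a decomposition with vectors having at most $k$ non-zero entries exists (the zero matrix being an empty sum, $r=0$). *)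

theory Defs
  imports
    "Jordan_Normal_Form.Schur_Decomposition"
    "Jordan_Normal_Form.DL_Rank"
    "HOL-Library.Extended_Nat"
begin

text \<open>
  The definitions are generic in the scalars, to be used at \<^typ>\<open>real\<close> (where
  \<^const>\<open>conjugate\<close> is the identity) and \<^typ>\<open>complex\<close> (where it is \<^const>\<open>cnj\<close>).
  The order on \<^typ>\<open>complex\<close> is the one of \<^theory>\<open>HOL-Library.Complex_Order\<close>, so that
  \<open>0 \<le> z\<close> means that \<open>z\<close> is real and nonnegative.
\<close>

definition psd_mats :: "nat \<Rightarrow> 'a :: conjugatable_ordered_field mat set" where
  "psd_mats n = {A \<in> carrier_mat n n.
     mat_adjoint A = A \<and> (\<forall>v \<in> carrier_vec n. 0 \<le> (A *\<^sub>v v) \<bullet>c v)}"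

text \<open>Indices start at 0, so the distinguished first row and column have index 0.\<close>

definition arrowhead :: "'a :: zero mat \<Rightarrow> bool" where
  "arrowhead A \<longleftrightarrow>
     (\<forall>i < dim_row A. \<forall>j < dim_col A. i \<noteq> 0 \<and> j \<noteq> 0 \<and> i \<noteq> j \<longrightarrow> A $$ (i, j) = 0)"

definition nnz :: "'a :: zero vec \<Rightarrow> nat" where
  "nnz v = card {i. i < dim_vec v \<and> v $ i \<noteq> 0}"

text \<open>The matrix \<open>v v\<^sup>*\<close>.\<close>

definition self_outer :: "'a :: conjugatable_ordered_field vec \<Rightarrow> 'a mat" where
  "self_outer v = mat (dim_vec v) (dim_vec v) (\<lambda>(i, j). v $ i * conjugate (v $ j))"

definition sparse_decomp ::
  "nat \<Rightarrow> 'a :: conjugatable_ordered_field mat \<Rightarrow> 'a vec list \<Rightarrow> bool" where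
  "sparse_decomp k A vs \<longleftrightarrow>
     (\<forall>v \<in> set vs. v \<in> carrier_vec (dim_row A) \<and> nnz v \<le> k) \<and>
     A = foldr (+) (map self_outer vs) (0\<^sub>m (dim_row A) (dim_row A))"

text \<open>
  Both minima are taken in \<^typ>\<open>enat\<close>: the value is \<open>\<infinity>\<close> if there is no decomposition, so a
  finite value or upper bound entails that a decomposition exists.
\<close>

definition factor_width :: "'a :: conjugatable_ordered_field mat \<Rightarrow> enat" where
  "factor_width A = (INF k \<in> {k. 0 < k \<and> (\<exists>vs. sparse_decomp k A vs)}. enat k)"

definition fran :: "nat \<Rightarrow> 'a :: conjugatable_ordered_field mat \<Rightarrow> enat" where
  "fran k A = (INF r \<in> {r. \<exists>vs. sparse_decomp k A vs \<and> length vs = r}. enat r)"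

lemma INF_enat_eq:
  "(INF k \<in> S. enat k) = (if S = {} then \<infinity> else enat (LEAST k. k \<in> S))"
proof (cases "S = {}")
  case True
  then show ?thesis by (simp add: top_enat_def)
next
  case False
  then have "(LEAST k. k \<in> S) \<in> S" by (metis LeastI_ex ex_in_conv)
  then have "(INF k \<in> S. enat k) = enat (LEAST k. k \<in> S)"
    by (intro antisym INF_lower INF_greatest) (auto intro: Least_le)
  with False show ?thesis by simp
qed

end

theory Submission
  imports Defs
begin

text \<open>
  The heart of the matter is one explicit decomposition. Eliminating the border of an arrowhead
  matrix from the bottom right corner upwards is a Cholesky factorisation without fill-in. For
  \<open>j > 0\<close> with \<open>a\<^sub>j\<^sub>j \<noteq> 0\<close> the vector \<open>u\<^sub>j\<close> that reproduces row and column \<open>j\<close> of \<open>A\<close> is supported on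
  \<open>{0, j}\<close>, and subtracting all \<open>u\<^sub>j u\<^sub>j\<^sup>*\<close> leaves only the entry at \<open>(0, 0)\<close>, which becomes the Schur
  complement \<open>a\<^sub>0\<^sub>0 - (\<Sum>j>0. a\<^sub>0\<^sub>j a\<^sub>j\<^sub>0 / a\<^sub>j\<^sub>j)\<close>. It is a value of the quadratic form of \<open>A\<close>, hence
  nonnegative, and contributes a last vector \<open>u\<^sub>0\<close> supported on \<open>{0}\<close> if it is nonzero. Positive
  semidefiniteness also forces \<open>a\<^sub>j\<^sub>0 = 0\<close> whenever \<open>a\<^sub>j\<^sub>j = 0\<close> (\<open>psd_arrowhead_zero_diag\<close>), so that no
  vector is needed for such \<open>j\<close>. This is the decomposition in \<open>psd_arrowhead_decomp\<close>.

  The number of these vectors is the rank of \<open>A\<close> because \<open>u\<^sub>j\<close> ends in the nonzero entry at index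
  \<open>j\<close>: completing the family by the unit vectors at the missing indices gives the columns of an
  invertible triangular matrix \<open>W\<close>, so \<open>n = rank (W W\<^sup>*)\<close>, while \<open>W W\<^sup>*\<close> differs from \<open>A\<close> by one
  rank-one summand for each added unit vector (\<open>rank_outer_sum_echelon\<close>). Conversely no decomposition
  has fewer than \<open>rank A\<close> vectors (\<open>rank_outer_sum_le\<close>), by subadditivity of the rank.

  What the construction needs of the scalars, besides being an ordered field with a conjugation,
  is that every nonnegative element has the form \<open>s * conjugate s\<close>; the argument is
  carried out once under this assumption.
\<close>

section \<open>Conjugation in fields\<close>

lemma conjugate_one: "conjugate (1 :: 'a :: conjugatable_field) = 1"
proof -
  have "conjugate (1 :: 'a) * conjugate 1 = conjugate 1 * 1"
    by (simp flip: conjugate_dist_mul)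
  moreover have "conjugate (1 :: 'a) \<noteq> 0" by simp
  ultimately show ?thesis using mult_left_cancel by blast
qed

lemma conjugate_divide:
  "conjugate (x / y) = conjugate x / conjugate (y :: 'a :: conjugatable_field)"
proof (cases "y = 0")
  case False
  then have "conjugate (x / y) * conjugate y = conjugate x"
    by (simp flip: conjugate_dist_mul)
  with False show ?thesis by (simp add: eq_divide_eq)
qed simp

section \<open>Sums of self-outer products and their rank\<close>

abbreviation outer_sum :: "nat \<Rightarrow> 'a :: conjugatable_ordered_field vec list \<Rightarrow> 'a mat" where
  "outer_sum n vs \<equiv> foldr (+) (map self_outer vs) (0\<^sub>m n n)"

lemma self_outer_carrier: "v \<in> carrier_vec n \<Longrightarrow> self_outer v \<in> carrier_mat n n"
  by (simp add: self_outer_def)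

lemma outer_sum_carrier: "set vs \<subseteq> carrier_vec n \<Longrightarrow> outer_sum n vs \<in> carrier_mat n n"
  by (induction vs) (auto simp: self_outer_carrier)

lemma outer_sum_index:
  assumes "set vs \<subseteq> carrier_vec n" "i < n" "j < n"
  shows "outer_sum n vs $$ (i, j) = (\<Sum>v\<leftarrow>vs. v $ i * conjugate (v $ j))"
  using assms(1)
proof (induction vs)
  case Nil
  then show ?case using assms by simp
next
  case (Cons v vs)
  then have "outer_sum n vs \<in> carrier_mat n n" by (intro outer_sum_carrier) simp
  then have "outer_sum n (v # vs) $$ (i, j) = self_outer v $$ (i, j) + outer_sum n vs $$ (i, j)"
    using assms by simp
  moreover have "self_outer v $$ (i, j) = v $ i * conjugate (v $ j)"
    using Cons.prems assms by (auto simp: self_outer_def)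
  ultimately show ?case using Cons by simp
qed

text \<open>
  Filtering an index range, instead of listing the vectors, turns the entries into sums over a fixed
  range, in which a family can be split or zero vectors reinstated.
\<close>

lemma outer_sum_filter_index:
  assumes "\<And>k. k < n \<Longrightarrow> P k \<Longrightarrow> u k \<in> carrier_vec n" "i < n" "j < n"
  shows "outer_sum n (map u (filter P [0..<n])) $$ (i, j)
    = (\<Sum>k<n. if P k then u k $ i * conjugate (u k $ j) else 0)"
proof -
  have "outer_sum n (map u (filter P [0..<n])) $$ (i, j)
    = (\<Sum>k\<leftarrow>filter P [0..<n]. u k $ i * conjugate (u k $ j))"
    using assms by (subst outer_sum_index) (auto simp: comp_def)
  also have "\<dots> = (\<Sum>k\<leftarrow>[0..<n]. if P k then u k $ i * conjugate (u k $ j) else 0)"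
    by (simp add: sum_list_map_filter')
  also have "\<dots> = (\<Sum>k<n. if P k then u k $ i * conjugate (u k $ j) else 0)"
    by (simp add: sum_list_distinct_conv_sum_set atLeast0LessThan)
  finally show ?thesis .
qed

lemma rank_outer_sum_le:
  assumes "set vs \<subseteq> carrier_vec n"
  shows "vec_space.rank n (outer_sum n vs) \<le> length vs"
  using assms
proof (induction vs)
  case Nil
  then show ?case by (simp add: vec_space.rank_0I)
next
  case (Cons v vs)
  have "vec_space.rank n (self_outer v) \<le> 1"
    by (rule vec_space.rank_le_1_product_entries[where f = "\<lambda>i. v $ i"
          and g = "\<lambda>j. conjugate (v $ j)", OF self_outer_carrier])
       (use Cons in \<open>auto simp: self_outer_def\<close>)
  moreover have "vec_space.rank n (self_outer v + outer_sum n vs)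
      \<le> vec_space.rank n (self_outer v) + vec_space.rank n (outer_sum n vs)"
    by (rule vec_space.rank_subadditive[OF self_outer_carrier outer_sum_carrier])
       (use Cons in auto)
  ultimately show ?case using Cons by simp
qed

text \<open>
  With the vectors as columns of an upper triangular matrix \<open>M\<close>, the sum is \<open>M M\<^sup>*\<close>, and both factors
  have nonzero determinant.
\<close>

lemma rank_outer_sum_triangular:
  fixes w :: "nat \<Rightarrow> 'a :: conjugatable_ordered_field vec"
  assumes w: "\<And>j. j < n \<Longrightarrow> w j \<in> carrier_vec n"
    and diag: "\<And>j. j < n \<Longrightarrow> w j $ j \<noteq> 0"
    and tri: "\<And>i j. j < i \<Longrightarrow> i < n \<Longrightarrow> w j $ i = 0"
  shows "vec_space.rank n (outer_sum n (map w [0..<n])) = n"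
proof -
  define M where "M = mat n n (\<lambda>(i, j). w j $ i)"
  define N where "N = mat n n (\<lambda>(i, j). conjugate (w i $ j))"
  have [simp]: "M \<in> carrier_mat n n" "N \<in> carrier_mat n n"
    by (auto simp: M_def N_def)
  have "outer_sum n (map w [0..<n]) \<in> carrier_mat n n"
    by (rule outer_sum_carrier) (use w in auto)
  then have W: "dim_row (outer_sum n (map w [0..<n])) = n" "dim_col (outer_sum n (map w [0..<n])) = n"
    by blast+
  have prod: "outer_sum n (map w [0..<n]) = M * N"
  proof (rule eq_matI)
    fix i j assume "i < dim_row (M * N)" "j < dim_col (M * N)"
    then have ij: "i < n" "j < n" by (auto simp: M_def N_def)
    then have "outer_sum n (map w [0..<n]) $$ (i, j) = (\<Sum>k<n. w k $ i * conjugate (w k $ j))"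
      using outer_sum_filter_index[of n "\<lambda>_. True" w i j] w by simp
    then show "outer_sum n (map w [0..<n]) $$ (i, j) = (M * N) $$ (i, j)"
      using ij by (simp add: M_def N_def scalar_prod_def atLeast0LessThan)
  qed (use W in \<open>auto simp: M_def N_def\<close>)
  have "det M = (\<Prod>j = 0..<n. w j $ j)"
    using tri by (subst det_upper_triangular[of _ n]) (auto simp: M_def prod_list_diag_prod)
  then have "det M \<noteq> 0" using diag by simp
  moreover have "det N = (\<Prod>j = 0..<n. conjugate (w j $ j))"
    using tri by (subst det_lower_triangular[of n]) (auto simp: N_def prod_list_diag_prod)
  then have "det N \<noteq> 0" using diag by simp
  ultimately have "det (M * N) \<noteq> 0" by (simp add: det_mult[of _ n])
  then show ?thesis
    unfolding prod by (intro vec_space.low_rank_det_zero mult_carrier_mat[of _ n n]) simp_all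
qed

text \<open>
  The lower bound on the rank is obtained by completion: with the unit vector \<open>e\<^sub>j\<close> at each index \<open>j\<close>
  outside \<open>P\<close>, the family becomes triangular of full rank \<open>n\<close>, and each of these added vectors
  raises the rank by at most one.
\<close>

lemma rank_outer_sum_echelon:
  fixes u :: "nat \<Rightarrow> 'a :: conjugatable_ordered_field vec"
  assumes u: "\<And>j. j < n \<Longrightarrow> P j \<Longrightarrow> u j \<in> carrier_vec n"
    and diag: "\<And>j. j < n \<Longrightarrow> P j \<Longrightarrow> u j $ j \<noteq> 0"
    and tri: "\<And>i j. j < i \<Longrightarrow> i < n \<Longrightarrow> P j \<Longrightarrow> u j $ i = 0"
  shows "vec_space.rank n (outer_sum n (map u (filter P [0..<n]))) = length (filter P [0..<n])"
proof (rule antisym)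
  let ?vs = "map u (filter P [0..<n])"
  let ?es = "map (unit_vec n) (filter (\<lambda>j. \<not> P j) [0..<n]) :: 'a vec list"
  define w where "w j = (if P j then u j else unit_vec n j)" for j
  have vs: "set ?vs \<subseteq> carrier_vec n" using u by auto
  have es: "set ?es \<subseteq> carrier_vec n" by auto
  note carr = outer_sum_carrier[OF vs] outer_sum_carrier[OF es]
  show "vec_space.rank n (outer_sum n ?vs) \<le> length (filter P [0..<n])"
    using rank_outer_sum_le[OF vs] by simp
  have w: "w j \<in> carrier_vec n" if "j < n" for j
    using u that by (simp add: w_def)
  have "outer_sum n (map w [0..<n]) \<in> carrier_mat n n"
    by (rule outer_sum_carrier) (use w in auto)
  then have W: "dim_row (outer_sum n (map w [0..<n])) = n" "dim_col (outer_sum n (map w [0..<n])) = n"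
    by blast+
  have split: "outer_sum n (map w [0..<n]) = outer_sum n ?vs + outer_sum n ?es"
  proof (rule eq_matI)
    fix i j assume "i < dim_row (outer_sum n ?vs + outer_sum n ?es)"
      "j < dim_col (outer_sum n ?vs + outer_sum n ?es)"
    then have ij: "i < n" "j < n" using carr by auto
    have "outer_sum n (map w [0..<n]) $$ (i, j) = (\<Sum>k<n. w k $ i * conjugate (w k $ j))"
      using outer_sum_filter_index[of n "\<lambda>_. True" w i j] w ij by simp
    also have "\<dots> = (\<Sum>k<n. if P k then u k $ i * conjugate (u k $ j) else 0)
       + (\<Sum>k<n. if \<not> P k then unit_vec n k $ i * conjugate (unit_vec n k $ j) else 0)"
      unfolding sum.distrib[symmetric] by (rule sum.cong) (auto simp: w_def)
    also have "\<dots> = outer_sum n ?vs $$ (i, j) + outer_sum n ?es $$ (i, j)"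
      using outer_sum_filter_index[of n P u i j, OF u]
        outer_sum_filter_index[of n "\<lambda>j. \<not> P j" "unit_vec n :: nat \<Rightarrow> 'a vec" i j] ij by simp
    finally show "outer_sum n (map w [0..<n]) $$ (i, j)
        = (outer_sum n ?vs + outer_sum n ?es) $$ (i, j)"
      using ij carr by simp
  qed (use carr W in auto)
  have "n = vec_space.rank n (outer_sum n (map w [0..<n]))"
    by (rule rank_outer_sum_triangular[symmetric, OF w]) (use diag tri in \<open>auto simp: w_def\<close>)
  also have "\<dots> \<le> vec_space.rank n (outer_sum n ?vs) + vec_space.rank n (outer_sum n ?es)"
    unfolding split by (rule vec_space.rank_subadditive[OF carr])
  also have "\<dots> \<le> vec_space.rank n (outer_sum n ?vs) + length (filter (\<lambda>j. \<not> P j) [0..<n])"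
    using rank_outer_sum_le[OF es] by simp
  finally show "length (filter P [0..<n]) \<le> vec_space.rank n (outer_sum n ?vs)"
    using sum_length_filter_compl[of P "[0..<n]"] by simp
qed

section \<open>Positive semidefinite arrowhead matrices\<close>

lemma psd_mats_index_conjugate:
  assumes "A \<in> psd_mats n" "i < n" "j < n"
  shows "conjugate (A $$ (i, j)) = A $$ (j, i)"
proof -
  have carr: "A \<in> carrier_mat n n" and "mat_adjoint A = A" using assms by (auto simp: psd_mats_def)
  from carr have "mat_adjoint A $$ (j, i) = conjugate (A $$ (i, j))"
    using assms(2,3) by (simp add: mat_adjoint_def mat_of_rows_index)
  with \<open>mat_adjoint A = A\<close> show ?thesis by simp
qed

lemma psd_mats_diag_nonneg:
  assumes A: "A \<in> psd_mats n" and i: "i < n"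
  shows "0 \<le> A $$ (i, i)"
proof -
  have carr: "A \<in> carrier_mat n n" using A by (simp add: psd_mats_def)
  have "conjugate (unit_vec n i) = (unit_vec n i :: 'a vec)"
    by (rule eq_vecI) (auto simp: unit_vec_def conjugate_one)
  then have "(A *\<^sub>v unit_vec n i) \<bullet>c unit_vec n i = (A *\<^sub>v unit_vec n i) $ i"
    using carr i by simp
  also have "\<dots> = A $$ (i, i)" using carr i by simp
  finally show ?thesis
    using A unfolding psd_mats_def by (metis (mono_tags, lifting) mem_Collect_eq unit_vec_carrier)
qed

text \<open>
  The quadratic form is only needed at vectors with leading entry 1: this normalisation covers both
  consequences of semidefiniteness below.
\<close>

lemma arrowhead_quadratic_form:
  fixes A :: "'a :: conjugatable_ordered_field mat" and y :: "nat \<Rightarrow> 'a"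
  assumes A: "A \<in> carrier_mat n n" and arrow: "arrowhead A" and n: "0 < n"
  defines "x \<equiv> vec n (\<lambda>i. if i = 0 then 1 else y i)"
  shows "(A *\<^sub>v x) \<bullet>c x = A $$ (0, 0) + (\<Sum>j = 1..<n. A $$ (0, j) * y j)
    + (\<Sum>i = 1..<n. (A $$ (i, 0) + A $$ (i, i) * y i) * conjugate (y i))"
proof -
  have split: "(\<Sum>j = 0..<n. f j) = f 0 + (\<Sum>j = 1..<n. f j)" for f :: "nat \<Rightarrow> 'a"
    using n by (simp add: sum.atLeast_Suc_lessThan)
  have row: "(A *\<^sub>v x) $ i = (\<Sum>j = 0..<n. A $$ (i, j) * x $ j)" if "i < n" for i
    using A that by (simp add: scalar_prod_def x_def)
  have row0: "(A *\<^sub>v x) $ 0 = A $$ (0, 0) + (\<Sum>j = 1..<n. A $$ (0, j) * y j)"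
    using n by (simp add: row split) (simp add: x_def)
  have rowi: "(A *\<^sub>v x) $ i = A $$ (i, 0) + A $$ (i, i) * y i" if "i \<in> {1..<n}" for i
  proof -
    have "(\<Sum>j = 1..<n. A $$ (i, j) * x $ j) = (\<Sum>j = 1..<n. if j = i then A $$ (i, i) * y i else 0)"
      by (rule sum.cong) (use that A arrow in \<open>auto simp: arrowhead_def x_def\<close>)
    then show ?thesis using that n by (simp add: row split) (simp add: x_def)
  qed
  have "(A *\<^sub>v x) \<bullet>c x = (\<Sum>i = 0..<n. (A *\<^sub>v x) $ i * conjugate (x $ i))"
    by (simp add: scalar_prod_def x_def)
  also have "\<dots> = (A *\<^sub>v x) $ 0 + (\<Sum>i = 1..<n. (A *\<^sub>v x) $ i * conjugate (y i))"
    using n by (simp add: split) (simp add: x_def conjugate_one)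
  finally show ?thesis by (simp add: row0 rowi)
qed

lemma psd_arrowhead_quadratic_form_nonneg:
  fixes A :: "'a :: conjugatable_ordered_field mat"
  assumes A: "A \<in> psd_mats n" and arrow: "arrowhead A" and n: "0 < n"
  shows "0 \<le> A $$ (0, 0) + (\<Sum>j = 1..<n. A $$ (0, j) * y j)
    + (\<Sum>i = 1..<n. (A $$ (i, 0) + A $$ (i, i) * y i) * conjugate (y i))"
proof -
  have "A \<in> carrier_mat n n" using A by (simp add: psd_mats_def)
  from arrowhead_quadratic_form[OF this arrow n, of y, symmetric] show ?thesis
    using A by (simp add: psd_mats_def)
qed

text \<open>
  If \<open>a\<^sub>i\<^sub>i = 0\<close>, the quadratic form at \<open>e\<^sub>0 + t e\<^sub>i\<close> is \<open>a\<^sub>0\<^sub>0\<close> plus the two conjugate cross terms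
  \<open>a\<^sub>0\<^sub>i t\<close> and \<open>a\<^sub>i\<^sub>0 (conjugate t)\<close>, whose sum can be made arbitrarily negative unless \<open>a\<^sub>i\<^sub>0 = 0\<close>.
\<close>

lemma psd_arrowhead_zero_diag:
  fixes A :: "'a :: conjugatable_ordered_field mat"
  assumes A: "A \<in> psd_mats n" and arrow: "arrowhead A" and i: "0 < i" "i < n"
    and zero: "A $$ (i, i) = 0"
  shows "A $$ (i, 0) = 0"
proof (rule ccontr)
  let ?a = "A $$ (0, 0)" and ?b = "A $$ (i, 0)"
  assume b: "?b \<noteq> 0"
  have n: "0 < n" using i by simp
  have conj: "conjugate ?a = ?a" "A $$ (0, i) = conjugate ?b"
    using psd_mats_index_conjugate[OF A] i by auto
  \<comment> \<open>Both cross terms become \<open>- (?a + 1)\<close>, and the form takes the negative value \<open>- ?a - 2\<close>.\<close>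
  define t where "t = - (?a + 1) / conjugate ?b"
  define y where "y j = (if j = i then t else 0)" for j
  have "conjugate ?b * t = - (?a + 1)" using b by (simp add: t_def)
  moreover have "?b * conjugate t = - (?a + 1)"
    using b by (simp add: t_def conjugate_divide conjugate_neg conjugate_dist_add conj conjugate_one
        del: minus_add_distrib add_uminus_conv_diff)
  moreover have "(\<Sum>j = 1..<n. A $$ (0, j) * y j) = conjugate ?b * t"
  proof -
    have "(\<Sum>j = 1..<n. A $$ (0, j) * y j)
        = (\<Sum>j = 1..<n. if j = i then conjugate ?b * t else 0)"
      by (rule sum.cong) (auto simp: y_def conj)
    then show ?thesis using i by simp
  qed
  moreover have "(\<Sum>j = 1..<n. (A $$ (j, 0) + A $$ (j, j) * y j) * conjugate (y j))
      = ?b * conjugate t"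
  proof -
    have "(\<Sum>j = 1..<n. (A $$ (j, 0) + A $$ (j, j) * y j) * conjugate (y j))
        = (\<Sum>j = 1..<n. if j = i then ?b * conjugate t else 0)"
      by (rule sum.cong) (auto simp: y_def zero)
    then show ?thesis using i by simp
  qed
  ultimately have "0 \<le> ?a + - (?a + 1) + - (?a + 1)"
    using psd_arrowhead_quadratic_form_nonneg[OF A arrow n, of y] by simp
  then have "(?a + 1 + 1) + 0 \<le> (?a + 1 + 1) + (?a + - (?a + 1) + - (?a + 1))"
    by (rule add_left_mono)
  then have "?a + 1 + 1 \<le> 0" by simp
  moreover have one: "(0 :: 'a) \<le> 1"
    using conjugate_square_positive[of "1 :: 'a"] by (simp add: conjugate_one)
  have "0 + 1 \<le> ?a + 1 + (1 :: 'a)"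
    by (intro add_mono add_nonneg_nonneg psd_mats_diag_nonneg[OF A n] one order.refl)
  ultimately have "(1 :: 'a) \<le> 0" by simp
  with one show False by simp
qed

text \<open>
  The Schur complement is the value of the quadratic form at the vector with leading entry 1 whose
  other entries minimise it. Since \<open>x / 0 = 0\<close>, summands with \<open>a\<^sub>j\<^sub>j = 0\<close> vanish and the choice of \<open>y\<close>
  is uniform.
\<close>

lemma psd_arrowhead_schur_nonneg:
  fixes A :: "'a :: conjugatable_ordered_field mat"
  assumes A: "A \<in> psd_mats n" and arrow: "arrowhead A" and n: "0 < n"
  shows "0 \<le> A $$ (0, 0) - (\<Sum>j = 1..<n. A $$ (0, j) * A $$ (j, 0) / A $$ (j, j))"
proof -
  define y where "y j = - (A $$ (j, 0) / A $$ (j, j))" for j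
  have "(\<Sum>i = 1..<n. (A $$ (i, 0) + A $$ (i, i) * y i) * conjugate (y i)) = 0"
    by (rule sum.neutral) (auto simp: y_def)
  then show ?thesis
    using psd_arrowhead_quadratic_form_nonneg[OF A arrow n, of y]
    by (simp add: y_def sum_negf)
qed

text \<open>
  The columns \<open>u\<^sub>j\<close> of the Cholesky factor have pivots \<open>s\<^sub>j\<close>, where \<open>s\<^sub>j (conjugate s\<^sub>j)\<close> is \<open>a\<^sub>j\<^sub>j\<close> for
  \<open>j > 0\<close> and the Schur complement for \<open>j = 0\<close>. Their only other entry, at index 0, is chosen so that
  \<open>u\<^sub>j u\<^sub>j\<^sup>*\<close> has \<open>a\<^sub>j\<^sub>0\<close> at position \<open>(j, 0)\<close>.
\<close>

lemma psd_arrowhead_decomp: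
  fixes A :: "'a :: conjugatable_ordered_field mat"
  assumes sqrt: "\<And>x :: 'a. 0 \<le> x \<Longrightarrow> \<exists>s. s * conjugate s = x"
    and A: "A \<in> psd_mats n" and arrow: "arrowhead A"
  shows "\<exists>vs. sparse_decomp 2 A vs \<and> length vs = vec_space.rank n A"
proof -
  define p where "p j = (if j = 0
    then A $$ (0, 0) - (\<Sum>j = 1..<n. A $$ (0, j) * A $$ (j, 0) / A $$ (j, j))
    else A $$ (j, j))" for j
  have "0 \<le> p j" if "j < n" for j
    using that psd_arrowhead_schur_nonneg[OF A arrow] psd_mats_diag_nonneg[OF A]
    by (auto simp: p_def)
  then have "\<forall>j. \<exists>s. j < n \<longrightarrow> s * conjugate s = p j" using sqrt by blast
  then obtain s where s: "\<And>j. j < n \<Longrightarrow> s j * conjugate (s j) = p j" by metis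
  define u where "u j = vec n (\<lambda>i. if i = j then s j
    else if i = 0 then conjugate (A $$ (j, 0) / s j) else 0)" for j
  let ?vs = "map u (filter (\<lambda>j. s j \<noteq> 0) [0..<n])"
  have carr: "A \<in> carrier_mat n n" using A by (simp add: psd_mats_def)
  have u: "u j \<in> carrier_vec n" for j by (simp add: u_def)
  have low: "(\<Sum>k<n. u k $ i * conjugate (u k $ j)) = A $$ (i, j)"
    if i: "0 < i" "i < n" and j: "j < n" for i j
  proof -
    have "(\<Sum>k<n. u k $ i * conjugate (u k $ j))
        = (\<Sum>k<n. if k = i then s i * conjugate (u i $ j) else 0)"
      by (rule sum.cong) (use i in \<open>auto simp: u_def\<close>)
    also have "\<dots> = s i * conjugate (u i $ j)" using i by simp
    also have "\<dots> = A $$ (i, j)"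
    proof (cases "j = 0 \<or> j = i")
      case True
      have "s i = 0 \<Longrightarrow> A $$ (i, 0) = 0"
        using psd_arrowhead_zero_diag[OF A arrow i] s[OF i(2)] i by (simp add: p_def)
      with True show ?thesis using i j s[OF i(2)] by (auto simp: u_def p_def)
    next
      case False
      then show ?thesis using i j arrow carr by (auto simp: u_def arrowhead_def)
    qed
    finally show ?thesis .
  qed
  have corner: "(\<Sum>k<n. u k $ 0 * conjugate (u k $ 0)) = A $$ (0, 0)" if n: "0 < n"
  proof -
    have "u k $ 0 * conjugate (u k $ 0) = A $$ (0, k) * A $$ (k, 0) / A $$ (k, k)"
      if k: "k \<in> {1..<n}" for k
    proof -
      have "s k * conjugate (s k) = A $$ (k, k)" using s[of k] k by (simp add: p_def)
      moreover have "conjugate (A $$ (k, 0)) = A $$ (0, k)"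
        using psd_mats_index_conjugate[OF A] k by simp
      moreover have "u k $ 0 = conjugate (A $$ (k, 0) / s k)" using k n by (simp add: u_def)
      moreover have "conjugate (A $$ (0, k)) = A $$ (k, 0)"
        using psd_mats_index_conjugate[OF A] k by simp
      ultimately show ?thesis by (simp add: conjugate_divide mult.commute)
    qed
    then have "(\<Sum>k = 1..<n. u k $ 0 * conjugate (u k $ 0))
        = (\<Sum>k = 1..<n. A $$ (0, k) * A $$ (k, 0) / A $$ (k, k))"
      by (rule sum.cong[OF refl])
    moreover have "u 0 $ 0 * conjugate (u 0 $ 0) = p 0" using s[OF n] n by (simp add: u_def)
    ultimately show ?thesis
      using n by (simp add: lessThan_atLeast0 sum.atLeast_Suc_lessThan p_def)
  qed
  have entries: "(\<Sum>k<n. u k $ i * conjugate (u k $ j)) = A $$ (i, j)"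
    if ij: "i < n" "j < n" for i j
  proof (cases "i = 0 \<and> 0 < j")
    case True
    have "(\<Sum>k<n. u k $ i * conjugate (u k $ j))
        = conjugate (\<Sum>k<n. u k $ j * conjugate (u k $ i))"
      by (simp add: sum_conjugate conjugate_dist_mul mult.commute)
    then show ?thesis
      using low[of j i] True ij psd_mats_index_conjugate[OF A, of j i] by simp
  next
    case False
    then show ?thesis using low[of i j] corner ij by (cases "i = 0") auto
  qed
  have decomp: "A = outer_sum n ?vs"
  proof (rule eq_matI)
    have "outer_sum n ?vs \<in> carrier_mat n n" using u by (intro outer_sum_carrier) auto
    then show "dim_row A = dim_row (outer_sum n ?vs)" "dim_col A = dim_col (outer_sum n ?vs)"
      using carr by auto
    fix i j assume "i < dim_row (outer_sum n ?vs)" "j < dim_col (outer_sum n ?vs)"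
    with \<open>outer_sum n ?vs \<in> carrier_mat n n\<close> have ij: "i < n" "j < n" by auto
    have "outer_sum n ?vs $$ (i, j)
        = (\<Sum>k<n. if s k \<noteq> 0 then u k $ i * conjugate (u k $ j) else 0)"
      by (rule outer_sum_filter_index[OF u ij])
    \<comment> \<open>Since \<open>x / 0 = 0\<close>, a column with zero pivot is the zero vector.\<close>
    also have "\<dots> = (\<Sum>k<n. u k $ i * conjugate (u k $ j))"
      by (rule sum.cong) (use ij in \<open>auto simp: u_def\<close>)
    finally show "A $$ (i, j) = outer_sum n ?vs $$ (i, j)" using entries[OF ij] by simp
  qed
  have "vec_space.rank n (outer_sum n ?vs) = length ?vs"
    using rank_outer_sum_echelon[of n "\<lambda>j. s j \<noteq> 0" u] by (simp add: u_def)
  moreover have "nnz (u j) \<le> 2" for j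
  proof -
    have "{i. i < dim_vec (u j) \<and> u j $ i \<noteq> 0} \<subseteq> {0, j}"
      by (auto simp: u_def split: if_splits)
    then have "nnz (u j) \<le> card {0, j}" unfolding nnz_def by (rule card_mono[rotated]) simp
    also have "\<dots> \<le> 2" by (simp add: card_insert_if)
    finally show ?thesis .
  qed
  then have "sparse_decomp 2 A ?vs"
    unfolding sparse_decomp_def using decomp carr u by auto
  ultimately show ?thesis using decomp by (metis length_map)
qed

section \<open>Factor width and factor-width-\<open>k\<close> rank\<close>

lemma sparse_decomp_mono: "sparse_decomp k A vs \<Longrightarrow> k \<le> l \<Longrightarrow> sparse_decomp l A vs"
  by (auto simp: sparse_decomp_def)

lemma rank_le_fran:
  assumes "A \<in> carrier_mat n n"
  shows "enat (vec_space.rank n A) \<le> fran k A"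
  unfolding fran_def
proof (rule INF_greatest)
  fix r assume "r \<in> {r. \<exists>vs. sparse_decomp k A vs \<and> length vs = r}"
  then obtain vs where vs: "sparse_decomp k A vs" "length vs = r" by blast
  then have "set vs \<subseteq> carrier_vec n" "A = outer_sum n vs"
    using assms by (auto simp: sparse_decomp_def)
  then show "enat (vec_space.rank n A) \<le> enat r"
    using rank_outer_sum_le vs(2) by auto
qed

lemma psd_arrowhead_factor_width_fran:
  fixes A :: "'a :: conjugatable_ordered_field mat"
  assumes sqrt: "\<And>x :: 'a. 0 \<le> x \<Longrightarrow> \<exists>s. s * conjugate s = x"
    and A: "A \<in> psd_mats n" and arrow: "arrowhead A"
  shows "factor_width A \<le> 2" "k \<ge> 2 \<Longrightarrow> fran k A = enat (vec_space.rank n A)"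
proof -
  obtain vs where vs: "sparse_decomp 2 A vs" "length vs = vec_space.rank n A"
    using psd_arrowhead_decomp[OF sqrt A arrow] by blast
  have "factor_width A \<le> enat 2"
    unfolding factor_width_def by (rule INF_lower) (use vs in auto)
  then show "factor_width A \<le> 2" by (simp add: numeral_eq_enat)
  assume k: "k \<ge> 2"
  show "fran k A = enat (vec_space.rank n A)"
  proof (rule antisym)
    show "fran k A \<le> enat (vec_space.rank n A)"
      unfolding fran_def by (rule INF_lower) (use vs sparse_decomp_mono k in blast)
    show "enat (vec_space.rank n A) \<le> fran k A"
      using A by (intro rank_le_fran) (simp add: psd_mats_def)
  qed
qed

theorem theorem5:
  fixes n :: nat
  shows
    "(\<forall>A :: real mat. A \<in> psd_mats n \<and> arrowhead A \<longrightarrow>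
        factor_width A \<le> 2 \<and> (\<forall>k \<ge> 2. fran k A = enat (vec_space.rank n A))) \<and>
     (\<forall>A :: complex mat. A \<in> psd_mats n \<and> arrowhead A \<longrightarrow>
        factor_width A \<le> 2 \<and> (\<forall>k \<ge> 2. fran k A = enat (vec_space.rank n A)))"
proof -
  have real_sqrt: "\<exists>s. s * conjugate s = x" if "0 \<le> x" for x :: real
    using that by (intro exI[of _ "sqrt x"]) simp
  have complex_sqrt: "\<exists>s. s * conjugate s = z" if "0 \<le> z" for z :: complex
  proof -
    have "z = complex_of_real (Re z)" "0 \<le> Re z"
      using that by (auto simp: less_eq_complex_def complex_eq_iff)
    then show ?thesis
      by (intro exI[of _ "complex_of_real (sqrt (Re z))"]) (simp flip: of_real_mult)
  qed
  show ?thesis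
    using psd_arrowhead_factor_width_fran[OF real_sqrt]
      psd_arrowhead_factor_width_fran[OF complex_sqrt] by blast
qed

end
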